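(* Let $n\ge 1$ and let $X:\mathbb{R}^n\times\mathbb{R}\times\mathbb{R}\to\mathbb{R}^{n+2}$ be the constant vector field $X(x_1,\dots,x_n,y,z)=(0,\dots,0,0,1)$. Let $\delta>0$, $h>0$, and let $C=\partial B_\delta(0,\dots,0)\times[0,h]\subset\mathbb{R}^{n+2}$, where $B_\delta(0,\dots,0)\subset\mathbb{R}^{n+1}$. Let $\xi$ be given with $0<\xi<\delta$. Then to each pair of points $p\in\partial B_\delta(0,\dots,0)\times\{0\}$ and $q\in\partial B_\delta(0,\dots,0)\times\{h\}$ one can associate a $C^\infty$ vector field $Z=Z_{p,q}$ on $\mathbb{R}^{n+2}$ such that, denoting by $\theta$ the angle between the vectors $p-(0,\dots,0,0)$ and $q-(0,\dots,0,h)$: 1. $Z$ preserves the canonical volume form $dx_1\wedge\cdots\wedge dx_n\wedge dy\wedge dz$; 2. $Z\equiv X$ outside the cylinder ring $A_\xi(C)$; 3. the positive orbit of $p$ with respect to $Z$ contains $q$; 4. given $r\in\mathbb{N}$ and $\epsilon>0$, if $|\theta|$ is small enough (depending only on $r,\epsilon,\delta,h,\xi,n$), then $\|Z-X\|_r<\epsilon$.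
   Context: $B_\delta(x_1,\dots,x_n,y)\subset\mathbb{R}^{n+1}$ is the open ball with center $(x_1,\dots,x_n,y)$ and radius $\delta$, and $B_\delta[x_1,\dots,x_n,y]$ is the closed ball. For the cylinder $C=\partial B_\delta(x_1,\dots,x_n,y)\times[0,h]\subset\mathbb{R}^{n+2}$ and $0<\xi<\delta$, the cylinder ring with center at $C$ and radius $\xi$ is $A_\xi(C)=\big(B_{\delta+\xi}(x_1,\dots,x_n,y)\setminus B_{\delta-\xi}[x_1,\dots,x_n,y]\big)\times[0,h]\subset\mathbb{R}^{n+2}$. $\|\cdot\|_r$ denotes the $C^r$ norm on vector fields (supremum of all partial derivatives up to order $r$). The positive orbit of $p$ is its forward orbit under the flow of $Z$. *)

theory Defs
  imports "HOL-Analysis.Analysis"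
begin

text \<open>
  A point of \<open>\<real>\<^sup>n\<^sup>+\<^sup>2\<close> is written \<open>((x, y), z)\<close>, where \<open>x\<close> has the \<open>n = CARD('n) \<ge> 1\<close>
  coordinates \<open>x\<^sub>1, \<dots>, x\<^sub>n\<close>. The norm of a product type is Euclidean, so balls in
  \<open>(real ^ 'n) \<times> real\<close> are the Euclidean balls of \<open>\<real>\<^sup>n\<^sup>+\<^sup>1\<close>.
\<close>

type_synonym 'n base = "(real ^ 'n) \<times> real"
type_synonym 'n total = "'n base \<times> real"

definition vertical_field :: "'n::finite total \<Rightarrow> 'n total" where
  "vertical_field = (\<lambda>_. ((0, 0), 1))"

definition cylinder_ring :: "'n::finite base \<Rightarrow> real \<Rightarrow> real \<Rightarrow> real \<Rightarrow> 'n total set" where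
  "cylinder_ring c \<delta> h \<xi> = (ball c (\<delta> + \<xi>) - cball c (\<delta> - \<xi>)) \<times> {0..h}"

definition angle :: "'a::real_inner \<Rightarrow> 'a \<Rightarrow> real" where
  "angle u v = arccos ((u \<bullet> v) / (norm u * norm v))"

definition partial_deriv ::
    "'a::euclidean_space \<Rightarrow> ('a \<Rightarrow> 'b::real_normed_vector) \<Rightarrow> 'a \<Rightarrow> 'b" where
  "partial_deriv b f x = vector_derivative (\<lambda>t. f (x + t *\<^sub>R b)) (at 0)"

primrec iterated_partial ::
    "'a::euclidean_space list \<Rightarrow> ('a \<Rightarrow> 'b::real_normed_vector) \<Rightarrow> 'a \<Rightarrow> 'b" where
  "iterated_partial [] f = f"
| "iterated_partial (b # bs) f = partial_deriv b (iterated_partial bs f)"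

text \<open>\<open>C\<^sup>\<infinity>\<close>: all iterated partial derivatives exist everywhere and are continuous.\<close>

definition smooth :: "('a::euclidean_space \<Rightarrow> 'b::real_normed_vector) \<Rightarrow> bool" where
  "smooth f \<longleftrightarrow> (\<forall>bs \<in> lists Basis.
     continuous_on UNIV (iterated_partial bs f) \<and>
     (\<forall>b \<in> Basis. \<forall>x. (\<lambda>t. iterated_partial bs f (x + t *\<^sub>R b)) differentiable (at 0)))"

text \<open>The supremum is taken in \<^typ>\<open>ereal\<close>, so that it is \<open>\<infinity>\<close> if some derivative is unbounded.\<close>

definition Cr_norm :: "nat \<Rightarrow> ('a::euclidean_space \<Rightarrow> 'b::real_normed_vector) \<Rightarrow> ereal" where
  "Cr_norm r f = (SUP (bs, x) \<in> {bs \<in> lists Basis. length bs \<le> r} \<times> UNIV.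
     ereal (norm (iterated_partial bs f x)))"

definition is_flow ::
    "('a::real_normed_vector \<Rightarrow> 'a) \<Rightarrow> (real \<Rightarrow> 'a \<Rightarrow> 'a) \<Rightarrow> bool" where
  "is_flow Z \<phi> \<longleftrightarrow> (\<forall>x. \<phi> 0 x = x \<and>
     (\<forall>t. ((\<lambda>s. \<phi> s x) has_vector_derivative Z (\<phi> t x)) (at t)))"

definition positive_orbit :: "(real \<Rightarrow> 'a \<Rightarrow> 'a) \<Rightarrow> 'a \<Rightarrow> 'a set" where
  "positive_orbit \<phi> p = {\<phi> t p | t. 0 \<le> t}"

text \<open>
  The coordinate functions \<open>z\<close>, \<open>y\<close> and \<open>x\<^sub>i\<close> are indexed by \<open>None\<close>, \<open>Some None\<close> and
  \<open>Some (Some i)\<close>; the index type \<^typ>\<open>'n option option\<close> has \<open>n + 2\<close> elements.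
\<close>

definition coordinate :: "'n::finite option option \<Rightarrow> 'n total \<Rightarrow> real" where
  "coordinate k v = (case k of
       None \<Rightarrow> snd v
     | Some None \<Rightarrow> snd (fst v)
     | Some (Some i) \<Rightarrow> fst (fst v) $ i)"

text \<open>
  The form \<open>dx\<^sub>1 \<and> \<dots> \<and> dx\<^sub>n \<and> dy \<and> dz\<close> on an \<open>(n+2)\<close>-tuple of vectors. As the vectors are
  indexed by the same type as the coordinates, no ordering of the indices is needed.
\<close>

definition volume_form :: "('n::finite option option \<Rightarrow> 'n total) \<Rightarrow> real" where
  "volume_form v = det (\<chi> i j. coordinate i (v j))"

text \<open>\<open>F\<^sup>* \<omega> = \<omega>\<close> for the (constant) volume form \<open>\<omega>\<close>.\<close>

definition preserves_volume_form :: "('n::finite total \<Rightarrow> 'n total) \<Rightarrow> bool" where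
  "preserves_volume_form F \<longleftrightarrow> (\<forall>x. F differentiable (at x) \<and>
     (\<forall>v. volume_form (\<lambda>j. frechet_derivative F (at x) (v j)) = volume_form v))"

end

theory Submission
  imports Defs "HOL-Computational_Algebra.Polynomial"
begin

text \<open>
  Write \<open>e\<close> for the vertical unit vector, \<open>p = (a, 0)\<close> and \<open>q = (b, h)\<close>. Some plane through the
  origin of \<open>\<real>\<^sup>n\<^sup>+\<^sup>1\<close> contains \<open>a\<close> and \<open>b\<close>, and turning it by the angle \<open>\<theta>\<close> takes \<open>a\<close> to \<open>b\<close>
  (\<open>ex_oriented_plane\<close>). Let \<open>J\<close> be the skew map that generates the rotations \<open>R s = exp (s J)\<close>
  of this plane. The vector field is
  \<open>Z w = e + \<theta> P(w) g(w \<bullet> e) J w\<close>, where \<open>P\<close> is a bump function of the distance to the axis that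
  equals \<open>1\<close> at distance \<open>\<delta>\<close>, and \<open>g\<close> is a bump function of the height with integral \<open>1\<close> over
  \<open>[0, h]\<close>. While a point climbs at unit speed it is rotated about the axis; rotations preserve
  both the distance to the axis and the height, so the flow is explicit: with \<open>G' = g\<close>,
  \<open>\<phi> t w = R (\<theta> P(w) (G(w \<bullet> e + t) - G(w \<bullet> e))) w + t e\<close> (\<open>twist_is_flow\<close>). On the cylinder the
  angle accumulated between heights \<open>0\<close> and \<open>h\<close> is exactly \<open>\<theta>\<close>, whence \<open>\<phi> h p = q\<close>.

  The map \<open>\<phi> t\<close> preserves volume because it rotates each point by an angle \<open>\<sigma>(w)\<close> that is
  constant along the orbits of the rotation: its derivative is a shear in the direction
  \<open>J w\<close>, a vector on which the derivative of \<open>\<sigma>\<close> vanishes, followed by a rotation. Shears and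
  rotations both lie in one-parameter groups that an involution conjugates to their inverses,
  and this alone forces determinant \<open>1\<close> (\<open>volume_form_reversible_group\<close>).

  For the norm, \<open>Z - X\<close> is the product of the function \<open>\<zeta> = P g\<close>, which is independent of \<open>p\<close>
  and \<open>q\<close>, with the linear map \<open>\<theta> J\<close>. Expanding the latter in coordinates reduces all partial
  derivatives to those of finitely many fixed smooth functions of compact support, so
  \<open>\<parallel>Z - X\<parallel>\<^sub>r \<le> 2 C \<bar>\<theta>\<bar>\<close> with \<open>C\<close> depending only on \<open>r\<close> and \<open>\<zeta>\<close> (\<open>Cr_norm_scaleR_linear_le\<close>).
\<close>

section \<open>A flat function and its derivatives\<close>

text \<open>
  The \<open>k\<close>-th derivative of \<open>exp (- 1 / t)\<close> at \<open>t > 0\<close> is \<open>flat_poly k\<close> evaluated at \<open>1 / t\<close>, times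
  \<open>exp (- 1 / t)\<close>; the recursion is the product rule in the variable \<open>1 / t\<close>.
\<close>

primrec flat_poly :: "nat \<Rightarrow> real poly" where
  "flat_poly 0 = 1"
| "flat_poly (Suc k) = monom 1 2 * (flat_poly k - pderiv (flat_poly k))"

definition flat :: "nat \<Rightarrow> real \<Rightarrow> real" where
  "flat k t = (if t > 0 then poly (flat_poly k) (inverse t) * exp (- inverse t) else 0)"

lemma flat_nonzeroD: "flat k t \<noteq> 0 \<Longrightarrow> t > 0"
  by (simp add: flat_def split: if_splits)

lemma flat_0_pos: "t > 0 \<Longrightarrow> flat 0 t > 0"
  by (simp add: flat_def)

lemma poly_times_exp_minus_tendsto_0:
  "((\<lambda>x::real. poly p x * exp (- x)) \<longlongrightarrow> 0) at_top"
proof -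
  have "((\<lambda>x::real. \<Sum>i\<le>degree p. coeff p i * (x ^ i / exp x)) \<longlongrightarrow> 0) at_top"
    by (intro tendsto_null_sum tendsto_mult_right_zero tendsto_power_div_exp_0)
  then show ?thesis
    by (simp add: poly_altdef sum_distrib_right exp_minus divide_inverse mult.assoc)
qed

text \<open>
  Only \<open>t = 0\<close> needs an argument: dividing by \<open>t\<close> multiplies the polynomial in \<open>1 / t\<close> by one more
  power of its variable, and \<open>exp (- 1 / t)\<close> still beats it as \<open>t\<close> decreases to \<open>0\<close>.
\<close>

lemma flat_has_derivative: "(flat k has_real_derivative flat (Suc k) t) (at t)"
proof -
  consider "t > 0" | "t < 0" | "t = 0" by linarith
  then show ?thesis
  proof cases
    case 1
    have "((\<lambda>t. poly (flat_poly k) (inverse t) * exp (- inverse t))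
            has_real_derivative flat (Suc k) t) (at t)"
      using 1
      by (auto intro!: derivative_eq_intros DERIV_chain2[OF poly_DERIV]
            simp: flat_def poly_monom field_simps power2_eq_square)
    then show ?thesis
      by (rule has_field_derivative_transform_within_open[of _ _ _ "{0<..}"])
        (use 1 in \<open>auto simp: flat_def\<close>)
  next
    case 2
    have "((\<lambda>t. 0) has_real_derivative flat (Suc k) t) (at t)"
      using 2 by (simp add: flat_def)
    then show ?thesis
      by (rule has_field_derivative_transform_within_open[of _ _ _ "{..<0}"])
        (use 2 in \<open>auto simp: flat_def\<close>)
  next
    case 3
    have "((\<lambda>s. (flat k s - flat k 0) / (s - 0)) \<longlongrightarrow> 0) (at 0)"
    proof (rule filterlim_split_at)
      show "((\<lambda>s. (flat k s - flat k 0) / (s - 0)) \<longlongrightarrow> 0) (at_left 0)"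
        by (rule tendsto_eventually)
          (auto simp: eventually_at_filter flat_def intro!: always_eventually)
      have "((\<lambda>s. poly (pCons 0 (flat_poly k)) (inverse s) * exp (- inverse s)) \<longlongrightarrow> 0) (at_right 0)"
        by (rule filterlim_compose[OF poly_times_exp_minus_tendsto_0
              filterlim_inverse_at_top_right])
      then show "((\<lambda>s. (flat k s - flat k 0) / (s - 0)) \<longlongrightarrow> 0) (at_right 0)"
        by (rule Lim_transform_eventually)
          (auto simp: eventually_at_filter flat_def divide_inverse intro!: always_eventually)
    qed
    then show ?thesis
      using 3 by (simp add: has_field_derivative_iff flat_def)
  qed
qed

section \<open>Smooth functions\<close>

text \<open>
  The real functions built from the coordinates by sums, products and composition with the flat
  functions. The class contains the bump functions below and is closed under
  directional derivatives, which makes smoothness of its members immediate and dispenses with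
  general product and chain rules for iterated partial derivatives.
\<close>

inductive smooth_expr :: "('a::euclidean_space \<Rightarrow> real) \<Rightarrow> bool" where
  const: "smooth_expr (\<lambda>x. c)"
| coord: "smooth_expr (\<lambda>x. x \<bullet> b)"
| add: "smooth_expr f \<Longrightarrow> smooth_expr g \<Longrightarrow> smooth_expr (\<lambda>x. f x + g x)"
| mult: "smooth_expr f \<Longrightarrow> smooth_expr g \<Longrightarrow> smooth_expr (\<lambda>x. f x * g x)"
| flat: "smooth_expr f \<Longrightarrow> smooth_expr (\<lambda>x. flat k (f x))"

lemma smooth_expr_minus:
  assumes "smooth_expr f" "smooth_expr g"
  shows "smooth_expr (\<lambda>x. f x - g x)"
  using smooth_expr.add[OF assms(1) smooth_expr.mult[OF smooth_expr.const[of "-1"] assms(2)]]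
  by simp

lemma smooth_expr_inner_self: "smooth_expr (\<lambda>x::'a::euclidean_space. x \<bullet> x)"
proof -
  have "smooth_expr (\<lambda>x::'a. \<Sum>b\<in>B. (x \<bullet> b) * (x \<bullet> b))" if "finite B" for B
    using that
    by (induction B rule: finite_induct)
      (simp_all add: smooth_expr.const smooth_expr.add smooth_expr.mult smooth_expr.coord)
  from this[OF finite_Basis] show ?thesis
    by (simp only: euclidean_inner[symmetric])
qed

text \<open>
  Each way of forming an expression has a differentiation rule whose result is again an
  expression; for the flat functions this is why the whole sequence \<open>flat k\<close> is admitted.
\<close>

lemma smooth_expr_has_derivative:
  assumes "smooth_expr f"
  shows "\<exists>D. (\<forall>x. (f has_derivative D x) (at x)) \<and> (\<forall>b. smooth_expr (\<lambda>x. D x b))"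
  using assms
proof (induction rule: smooth_expr.induct)
  case (const c)
  show ?case
    by (intro exI[of _ "\<lambda>x h. 0"]) (auto intro: smooth_expr.const)
next
  case (coord b)
  show ?case
    by (intro exI[of _ "\<lambda>x h. h \<bullet> b"])
      (auto intro!: smooth_expr.const derivative_eq_intros)
next
  case (add f g)
  then obtain D E where "\<forall>x. (f has_derivative D x) (at x)" "\<forall>b. smooth_expr (\<lambda>x. D x b)"
    "\<forall>x. (g has_derivative E x) (at x)" "\<forall>b. smooth_expr (\<lambda>x. E x b)"
    by blast
  then show ?case
    by (intro exI[of _ "\<lambda>x h. D x h + E x h"])
      (auto intro!: smooth_expr.add derivative_intros)
next
  case (mult f g)
  then obtain D E where "\<forall>x. (f has_derivative D x) (at x)" "\<forall>b. smooth_expr (\<lambda>x. D x b)"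
    "\<forall>x. (g has_derivative E x) (at x)" "\<forall>b. smooth_expr (\<lambda>x. E x b)"
    by blast
  with mult.hyps show ?case
    by (intro exI[of _ "\<lambda>x h. f x * E x h + D x h * g x"])
      (auto intro!: smooth_expr.add smooth_expr.mult has_derivative_mult)
next
  case (flat f k)
  then obtain D where "\<forall>x. (f has_derivative D x) (at x)" "\<forall>b. smooth_expr (\<lambda>x. D x b)"
    by blast
  with flat.hyps show ?case
    by (intro exI[of _ "\<lambda>x h. D x h * flat (Suc k) (f x)"])
      (auto intro!: smooth_expr.mult smooth_expr.flat DERIV_compose_FDERIV[OF flat_has_derivative])
qed

lemma has_vector_derivative_directional:
  assumes "(f has_derivative D) (at x)"
  shows "((\<lambda>t. f (x + t *\<^sub>R b)) has_vector_derivative D b) (at 0)"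
proof -
  have "((\<lambda>t. x + t *\<^sub>R b) has_derivative (\<lambda>t. t *\<^sub>R b)) (at 0)"
    by (auto intro!: derivative_eq_intros)
  then have "((\<lambda>t. f (x + t *\<^sub>R b)) has_derivative (\<lambda>t. D (t *\<^sub>R b))) (at 0)"
    by (rule has_derivative_compose) (use assms in simp)
  then show ?thesis
    using linear_cmul[OF has_derivative_linear[OF assms]]
    by (simp add: has_vector_derivative_def)
qed

lemma smooth_expr_iterated_partial:
  assumes "smooth_expr f"
  shows "smooth_expr (iterated_partial bs f)"
proof (induction bs)
  case (Cons b bs)
  from smooth_expr_has_derivative[OF this] obtain D
    where D: "\<And>x. (iterated_partial bs f has_derivative D x) (at x)"
      and sD: "smooth_expr (\<lambda>x. D x b)" by blast
  have "iterated_partial (b # bs) f = (\<lambda>x. D x b)"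
    by (auto simp: partial_deriv_def fun_eq_iff
        intro: vector_derivative_at has_vector_derivative_directional[OF D])
  with sD show ?case by simp
qed (use assms in simp)

lemma smooth_expr_imp_smooth:
  assumes "smooth_expr f"
  shows "smooth f"
  unfolding smooth_def
proof (intro ballI allI conjI)
  fix bs :: "'a list" and b x :: 'a
  from smooth_expr_has_derivative[OF smooth_expr_iterated_partial[OF assms, of bs]] obtain D
    where D: "\<And>x. (iterated_partial bs f has_derivative D x) (at x)" by blast
  show "continuous_on UNIV (iterated_partial bs f)"
    using D by (auto intro!: continuous_at_imp_continuous_on has_derivative_continuous)
  show "(\<lambda>t. iterated_partial bs f (x + t *\<^sub>R b)) differentiable at 0"
    using has_vector_derivative_directional[OF D]
    by (rule differentiableI_vector)
qed

text \<open>
  Smoothness only speaks of differentiability, and \<open>partial_deriv\<close> of a value chosen by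
  description; this form lets the usual differentiation rules act on iterated partials.
\<close>

lemma smooth_has_partial_deriv:
  assumes "smooth f" "bs \<in> lists Basis" "b \<in> Basis"
  shows "((\<lambda>t. iterated_partial bs f (x + t *\<^sub>R b)) has_vector_derivative
           iterated_partial (b # bs) f x) (at 0)"
  using assms unfolding smooth_def
  by (auto simp: partial_deriv_def vector_derivative_works)

lemma iterated_partial_add:
  assumes "smooth f" "smooth g" "bs \<in> lists Basis"
  shows "iterated_partial bs (\<lambda>x. f x + g x) =
    (\<lambda>x. iterated_partial bs f x + iterated_partial bs g x)"
  using assms(3)
proof (induction bs)
  case (Cons b bs)
  then show ?case
    using has_vector_derivative_add[OF smooth_has_partial_deriv[OF assms(1), of bs b]
        smooth_has_partial_deriv[OF assms(2), of bs b], THEN vector_derivative_at]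
    by (auto simp: partial_deriv_def[of b "\<lambda>x. iterated_partial bs f x + iterated_partial bs g x"])
qed simp

lemma iterated_partial_bounded_linear:
  assumes "smooth f" "bounded_linear T" "bs \<in> lists Basis"
  shows "iterated_partial bs (\<lambda>x. T (f x)) = (\<lambda>x. T (iterated_partial bs f x))"
  using assms(3)
proof (induction bs)
  case (Cons b bs)
  then show ?case
    using bounded_linear.has_vector_derivative[OF assms(2) smooth_has_partial_deriv[OF assms(1), of bs b],
        THEN vector_derivative_at]
    by (auto simp: partial_deriv_def[of b "\<lambda>x. T (iterated_partial bs f x)"])
qed simp

lemma smooth_add:
  assumes "smooth f" "smooth g"
  shows "smooth (\<lambda>x. f x + g x)"
  using assms unfolding smooth_def
  by (auto simp: iterated_partial_add[OF assms] intro!: continuous_intros derivative_intros)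

lemma smooth_bounded_linear:
  assumes "smooth f" "bounded_linear T"
  shows "smooth (\<lambda>x. T (f x))"
  unfolding smooth_def
proof (intro ballI allI conjI)
  fix bs :: "'a list" and b x :: 'a
  assume bs: "bs \<in> lists Basis"
  show "continuous_on UNIV (iterated_partial bs (\<lambda>x. T (f x)))"
    using assms bs unfolding smooth_def
    by (auto simp: iterated_partial_bounded_linear[OF assms bs]
        intro: bounded_linear.continuous_on)
  assume "b \<in> Basis"
  from bounded_linear.has_vector_derivative[OF assms(2) smooth_has_partial_deriv[OF assms(1) bs this]]
  show "(\<lambda>t. iterated_partial bs (\<lambda>x. T (f x)) (x + t *\<^sub>R b)) differentiable at 0"
    unfolding iterated_partial_bounded_linear[OF assms bs] by (rule differentiableI_vector)
qed

lemma smooth_const: "smooth (\<lambda>x. c)"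
  using smooth_bounded_linear[OF smooth_expr_imp_smooth[OF smooth_expr.const[of 1]]
      bounded_linear_scaleR_left[of c]]
  by simp

lemma smooth_sum:
  assumes "finite I" "\<And>i. i \<in> I \<Longrightarrow> smooth (f i)"
  shows "smooth (\<lambda>x. \<Sum>i\<in>I. f i x)"
  using assms by (induction I rule: finite_induct) (auto intro: smooth_const smooth_add)

lemma iterated_partial_zero_on_open:
  assumes "open U" "\<And>x. x \<in> U \<Longrightarrow> f x = 0" "x \<in> U"
  shows "iterated_partial bs f x = 0"
  using assms(3)
proof (induction bs arbitrary: x)
  case (Cons b bs)
  have cont: "isCont (\<lambda>t. x + t *\<^sub>R b) 0"
    by (intro continuous_intros)
  have "\<forall>\<^sub>F t in nhds 0. x + t *\<^sub>R b \<in> U"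
    using cont assms(1) Cons.prems
    by (simp add: eventually_at_filter continuous_at_open eventually_nhds)
  then have "\<forall>\<^sub>F t in nhds 0. iterated_partial bs f (x + t *\<^sub>R b) = 0"
    by eventually_elim (rule Cons.IH)
  then have "((\<lambda>t. iterated_partial bs f (x + t *\<^sub>R b)) has_vector_derivative 0) (at 0)"
    by (subst has_vector_derivative_cong_ev[where g = "\<lambda>_. 0"])
      (auto simp: Cons elim: eventually_mono)
  then show ?case
    by (simp add: partial_deriv_def vector_derivative_at)
qed (use assms in simp)

lemma iterated_partial_sum:
  assumes "finite I" "\<And>i. i \<in> I \<Longrightarrow> smooth (f i)" "bs \<in> lists Basis"
  shows "iterated_partial bs (\<lambda>x. \<Sum>i\<in>I. f i x) x = (\<Sum>i\<in>I. iterated_partial bs (f i) x)"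
  using assms(1,2)
proof (induction I rule: finite_induct)
  case empty
  show ?case by (auto intro: iterated_partial_zero_on_open[OF open_UNIV])
next
  case (insert i I)
  then show ?case
    by (simp add: iterated_partial_add[OF _ smooth_sum assms(3)])
qed

text \<open>
  All partial derivatives vanish on the open complement of \<open>K\<close> together with the function, and on
  the compact \<open>K\<close> they are bounded by continuity.
\<close>

lemma bounded_iterated_partial:
  assumes "smooth f" "compact K" "\<And>x. x \<notin> K \<Longrightarrow> f x = 0" "bs \<in> lists Basis"
  shows "\<exists>M\<ge>0. \<forall>x. norm (iterated_partial bs f x) \<le> M"
proof -
  have "continuous_on K (iterated_partial bs f)"
    using assms(1,4) unfolding smooth_def by (blast intro: continuous_on_subset)
  from compact_imp_bounded[OF compact_continuous_image[OF this assms(2)]]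
  obtain M where M: "M > 0" "\<And>x. x \<in> K \<Longrightarrow> norm (iterated_partial bs f x) \<le> M"
    by (auto simp: bounded_pos)
  have "iterated_partial bs f x = 0" if "x \<notin> K" for x
    by (rule iterated_partial_zero_on_open[of "- K"])
      (use assms that in \<open>auto simp: compact_imp_closed open_Compl\<close>)
  with M have "norm (iterated_partial bs f x) \<le> M" for x
    by (cases "x \<in> K") auto
  with M(1) show ?thesis by (intro exI[of _ M]) auto
qed

text \<open>
  Separates the fixed scalar functions \<open>f x * (x \<bullet> b)\<close> from the constants \<open>L b\<close>, the only place
  where the linear map enters.
\<close>

lemma scaleR_linear_eq_sum:
  fixes L :: "'a::euclidean_space \<Rightarrow> 'b::real_normed_vector"
  assumes "linear L"
  shows "f x *\<^sub>R L x = (\<Sum>b\<in>Basis. (f x * (x \<bullet> b)) *\<^sub>R L b)"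
proof -
  have "L x = (\<Sum>b\<in>Basis. (x \<bullet> b) *\<^sub>R L b)"
    by (subst euclidean_representation[of x, symmetric])
      (simp add: linear_sum[OF assms] linear_cmul[OF assms] del: euclidean_representation)
  then show ?thesis
    by (simp add: scaleR_sum_right)
qed

lemma smooth_scaleR_linear:
  fixes L :: "'a::euclidean_space \<Rightarrow> 'b::real_normed_vector"
  assumes "smooth_expr f" "linear L"
  shows "smooth (\<lambda>x. f x *\<^sub>R L x)"
  unfolding scaleR_linear_eq_sum[OF assms(2)]
  by (intro smooth_sum finite_Basis smooth_bounded_linear[OF _ bounded_linear_scaleR_left]
      smooth_expr_imp_smooth smooth_expr.mult assms(1) smooth_expr.coord)

text \<open>
  The constant is uniform in \<open>L\<close>: it is a sum of bounds for the partial derivatives of the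
  functions \<open>f x * (x \<bullet> b)\<close> over the finitely many lists of at most \<open>r\<close> directions. This
  uniformity is what makes the smallness of the angle independent of the points \<open>p\<close> and \<open>q\<close>.
\<close>

lemma Cr_norm_scaleR_linear_le:
  fixes f :: "'a::euclidean_space \<Rightarrow> real"
  assumes f: "smooth_expr f" and K: "compact K" "\<And>x. x \<notin> K \<Longrightarrow> f x = 0"
  shows "\<exists>C\<ge>0. \<forall>(L :: 'a \<Rightarrow> 'b::real_normed_vector) B. linear L \<longrightarrow>
    (\<forall>b\<in>Basis. norm (L b) \<le> B) \<longrightarrow> Cr_norm r (\<lambda>x. f x *\<^sub>R L x) \<le> ereal (C * B)"
proof -
  define F where "F = (\<lambda>b x. f x * (x \<bullet> b))"
  have smF: "smooth (F b)" for b
    unfolding F_def by (intro smooth_expr_imp_smooth smooth_expr.mult f smooth_expr.coord)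
  have "\<forall>bs\<in>lists Basis. \<exists>M\<ge>0. \<forall>x. norm (iterated_partial bs (F b) x) \<le> M" for b
    using bounded_iterated_partial[OF smF[of b] K(1)] K(2) by (auto simp: F_def)
  then obtain M where M0: "\<And>b bs. bs \<in> lists Basis \<Longrightarrow> M b bs \<ge> 0"
    and M: "\<And>b bs x. bs \<in> lists Basis \<Longrightarrow> norm (iterated_partial bs (F b) x) \<le> M b bs"
    by metis
  define W where "W = {bs \<in> lists (Basis :: 'a set). length bs \<le> r}"
  have "finite W"
    using finite_lists_length_le[OF finite_Basis, of r]
    by (simp add: W_def lists_eq_set)
  define C where "C = (\<Sum>b\<in>Basis. \<Sum>bs\<in>W. M b bs)"
  have "C \<ge> 0"
    unfolding C_def by (intro sum_nonneg M0) (auto simp: W_def)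
  moreover have "Cr_norm r (\<lambda>x. f x *\<^sub>R L x) \<le> ereal (C * B)"
    if L: "linear L" and B: "\<And>b. b \<in> Basis \<Longrightarrow> norm (L b) \<le> B" for L :: "'a \<Rightarrow> 'b" and B
  proof -
    have "norm (iterated_partial bs (\<lambda>x. f x *\<^sub>R L x) x) \<le> C * B" if bs: "bs \<in> W" for bs x
    proof -
      have bsL: "bs \<in> lists Basis" using bs by (simp add: W_def)
      have "iterated_partial bs (\<lambda>x. f x *\<^sub>R L x) x =
          (\<Sum>b\<in>Basis. iterated_partial bs (F b) x *\<^sub>R L b)"
        unfolding scaleR_linear_eq_sum[OF L]
        by (subst iterated_partial_sum)
          (auto intro!: bsL
            smooth_bounded_linear[OF smF bounded_linear_scaleR_left, unfolded F_def]
            simp: iterated_partial_bounded_linear[OF smF bounded_linear_scaleR_left bsL,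
              unfolded F_def] F_def)
      also have "norm \<dots> \<le> (\<Sum>b\<in>Basis. (\<Sum>bs\<in>W. M b bs) * B)"
      proof (rule sum_norm_le)
        fix b :: 'a assume b: "b \<in> Basis"
        have "norm (iterated_partial bs (F b) x) \<le> M b bs"
          by (rule M[OF bsL])
        also have "\<dots> \<le> (\<Sum>bs\<in>W. M b bs)"
          by (rule member_le_sum[OF bs _ \<open>finite W\<close>]) (auto simp: W_def M0)
        finally show "norm (iterated_partial bs (F b) x *\<^sub>R L b) \<le> (\<Sum>bs\<in>W. M b bs) * B"
          using B[OF b] by (auto intro!: mult_mono intro: order_trans[OF abs_ge_zero])
      qed
      finally show ?thesis by (simp add: C_def sum_distrib_right)
    qed
    then show ?thesis
      unfolding Cr_norm_def W_def[symmetric] by (auto intro!: SUP_least)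
  qed
  ultimately show ?thesis by blast
qed


section \<open>Rotations in a plane\<close>

locale oriented_plane =
  fixes u v :: "'a::real_inner"
  assumes uu: "u \<bullet> u = 1" and vv: "v \<bullet> v = 1" and uv: "u \<bullet> v = 0"
begin

text \<open>
  The quarter turn of the plane from \<open>u\<close> to \<open>v\<close>, and zero on its orthogonal complement.
\<close>

definition J :: "'a \<Rightarrow> 'a" where
  "J w = (w \<bullet> u) *\<^sub>R v - (w \<bullet> v) *\<^sub>R u"

text \<open>
  The rotation by the angle \<open>s\<close>, that is \<open>exp (s J)\<close>; since \<open>J\<^sup>3 = - J\<close>, the exponential series
  collapses to this expression (Rodrigues' formula).
\<close>

definition R :: "real \<Rightarrow> 'a \<Rightarrow> 'a" where
  "R s w = w + sin s *\<^sub>R J w + (1 - cos s) *\<^sub>R J (J w)"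

lemma vu: "v \<bullet> u = 0"
  using uv by (simp add: inner_commute)

lemma bounded_linear_J: "bounded_linear J"
  unfolding J_def by (intro bounded_linear_intros)

lemmas linear_J = bounded_linear.linear[OF bounded_linear_J]
lemmas J_simps = linear_add[OF linear_J] linear_diff[OF linear_J] linear_cmul[OF linear_J]

lemma J_J: "J (J w) = - (w \<bullet> u) *\<^sub>R u - (w \<bullet> v) *\<^sub>R v"
  by (simp add: J_def inner_simps uu vv uv vu)

lemma J_J_J: "J (J (J w)) = - J w"
  unfolding J_J[of w] by (simp add: J_def inner_simps uu vv uv vu)

lemma norm_J_le: "norm (J w) \<le> 2 * norm w"
proof -
  have "norm u = 1" "norm v = 1"
    using uu vv by (simp_all add: norm_eq_sqrt_inner)
  then have "norm (J w) \<le> \<bar>w \<bullet> u\<bar> + \<bar>w \<bullet> v\<bar>" "\<bar>w \<bullet> u\<bar> \<le> norm w" "\<bar>w \<bullet> v\<bar> \<le> norm w"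
    using norm_triangle_ineq4[of "(w \<bullet> u) *\<^sub>R v" "(w \<bullet> v) *\<^sub>R u"]
      Cauchy_Schwarz_ineq2[of w u] Cauchy_Schwarz_ineq2[of w v]
    by (simp_all add: J_def)
  then show ?thesis by simp
qed

lemma linear_R: "linear (R s)"
  unfolding R_def by (intro linearI) (simp_all add: J_simps algebra_simps)

lemma R_0: "R 0 w = w"
  by (simp add: R_def)

lemma J_R: "J (R s w) = cos s *\<^sub>R J w + sin s *\<^sub>R J (J w)"
  by (simp add: R_def J_simps J_J_J algebra_simps)

lemma R_J: "R s (J w) = J (R s w)"
  by (simp add: R_def J_simps J_J_J algebra_simps)

lemma R_add: "R (s + t) w = R s (R t w)"
proof -
  have "R s (R t w) = R t w + sin s *\<^sub>R J (R t w) + (1 - cos s) *\<^sub>R J (J (R t w))"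
    by (rule R_def)
  also have "\<dots> = R (s + t) w"
    unfolding J_R by (simp add: R_def J_simps J_J_J sin_add cos_add algebra_simps)
  finally show ?thesis by simp
qed

lemma R_orthogonal:
  assumes "e \<bullet> u = 0" "e \<bullet> v = 0"
  shows "R s w \<bullet> e = w \<bullet> e" "R s (w + t *\<^sub>R e) = R s w + t *\<^sub>R e"
proof -
  have eq: "u \<bullet> e = 0" "v \<bullet> e = 0" using assms by (simp_all add: inner_commute)
  show "R s w \<bullet> e = w \<bullet> e"
    by (simp add: R_def J_def inner_simps eq)
  show "R s (w + t *\<^sub>R e) = R s w + t *\<^sub>R e"
    by (simp add: R_def J_def inner_simps assms algebra_simps)
qed

lemma inner_R: "R s w \<bullet> R s w = w \<bullet> w"
proof -
  define a b where "a = w \<bullet> u" and "b = w \<bullet> v"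
  have R: "R s w = w + (- sin s * b - (1 - cos s) * a) *\<^sub>R u + (sin s * a - (1 - cos s) * b) *\<^sub>R v"
    unfolding R_def J_J by (simp add: J_def a_def b_def algebra_simps)
  have "R s w \<bullet> R s w = w \<bullet> w + (a\<^sup>2 + b\<^sup>2) * ((sin s)\<^sup>2 + (cos s)\<^sup>2 - 1)"
    unfolding R inner_add_left inner_add_right inner_scaleR_left inner_scaleR_right
      uu vv uv vu inner_commute[of u w] inner_commute[of v w] a_def[symmetric] b_def[symmetric]
    by (algebra)
  then show ?thesis by simp
qed

lemma R_has_vector_derivative:
  assumes "(\<sigma> has_real_derivative \<sigma>') (at t)"
  shows "((\<lambda>t. R (\<sigma> t) w) has_vector_derivative \<sigma>' *\<^sub>R J (R (\<sigma> t) w)) (at t)"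
proof -
  have "((\<lambda>t. R (\<sigma> t) w) has_vector_derivative
      (cos (\<sigma> t) * \<sigma>') *\<^sub>R J w + (sin (\<sigma> t) * \<sigma>') *\<^sub>R J (J w)) (at t)"
    unfolding R_def using assms
    by (auto intro!: derivative_eq_intros simp: has_real_derivative_iff_has_vector_derivative[symmetric])
  then show ?thesis
    by (simp add: J_R algebra_simps)
qed

text \<open>
  If \<open>\<sigma>\<close> is constant along the circle through \<open>w\<close>, differentiating \<open>\<sigma> (R s w)\<close> in \<open>s\<close> shows that
  its derivative kills the tangent \<open>J w\<close> of the circle. The derivative of \<open>R (\<sigma> w) w\<close> is therefore
  a rotation after a shear.
\<close>

lemma twist_has_derivative:
  assumes \<sigma>: "(\<sigma> has_derivative D) (at w)" and inv: "\<And>s. \<sigma> (R s w) = \<sigma> w"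
  shows "((\<lambda>w. R (\<sigma> w) w) has_derivative (\<lambda>k. R (\<sigma> w) (k + D k *\<^sub>R J w))) (at w)"
    and "D (J w) = 0"
proof -
  note J' = bounded_linear.has_derivative[OF bounded_linear_J]
  have "((\<lambda>w. R (\<sigma> w) w) has_derivative
      (\<lambda>k. k + (sin (\<sigma> w) *\<^sub>R J k + (D k * cos (\<sigma> w)) *\<^sub>R J w)
             + ((1 - cos (\<sigma> w)) *\<^sub>R J (J k) + (D k * sin (\<sigma> w)) *\<^sub>R J (J w)))) (at w)"
    unfolding R_def using \<sigma> by (auto intro!: derivative_eq_intros J')
  then show "((\<lambda>w. R (\<sigma> w) w) has_derivative (\<lambda>k. R (\<sigma> w) (k + D k *\<^sub>R J w))) (at w)"
    by (rule has_derivative_eq_rhs)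
      (simp add: linear_add[OF linear_R] linear_cmul[OF linear_R] R_J J_R fun_eq_iff,
       simp add: R_def algebra_simps)
  have "((\<lambda>s. R s w) has_vector_derivative J w) (at 0)"
    using R_has_vector_derivative[of "\<lambda>s. s" 1 0 w] by (simp add: R_0)
  then have "((\<lambda>s. \<sigma> (R s w)) has_vector_derivative D (J w)) (at 0)"
    using vector_derivative_diff_chain_within[of "\<lambda>s. R s w" "J w" 0 UNIV \<sigma> D] \<sigma>
    by (simp add: R_0 o_def has_derivative_at_withinI)
  then show "D (J w) = 0"
    using vector_derivative_unique_at[of _ "D (J w)" 0 0] by (simp add: inv)
qed

text \<open>
  Along a trajectory \<open>P\<close> does not change and the height grows at unit rate, so the angular
  velocity \<open>P w * g (w \<bullet> e + t)\<close> is a known function of time and can be integrated.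
\<close>

lemma twist_is_flow:
  assumes e: "e \<bullet> e = 1" "e \<bullet> u = 0" "e \<bullet> v = 0"
    and P: "\<And>s w. P (R s w) = P w" "\<And>t w. P (w + t *\<^sub>R e) = P w"
    and G: "\<And>z. (G has_real_derivative g z) (at z)"
  shows "is_flow (\<lambda>w. e + (P w * g (w \<bullet> e)) *\<^sub>R J w)
    (\<lambda>t w. R (P w * (G (w \<bullet> e + t) - G (w \<bullet> e))) w + t *\<^sub>R e)"
  unfolding is_flow_def
proof (intro allI conjI)
  fix w and t :: real
  define \<sigma> where "\<sigma> = (\<lambda>t. P w * (G (w \<bullet> e + t) - G (w \<bullet> e)))"
  have "((\<lambda>t. G (w \<bullet> e + t)) has_real_derivative g (w \<bullet> e + t)) (at t)"
    by (rule DERIV_chain2[OF G, where Db = 1, simplified]) (auto intro!: derivative_eq_intros)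
  then have "(\<sigma> has_real_derivative P w * g (w \<bullet> e + t)) (at t)"
    unfolding \<sigma>_def by (auto intro!: derivative_eq_intros)
  from R_has_vector_derivative[OF this, of w]
  have "((\<lambda>t. R (\<sigma> t) w + t *\<^sub>R e) has_vector_derivative
      e + (P w * g (w \<bullet> e + t)) *\<^sub>R J (R (\<sigma> t) w)) (at t)"
    by (auto intro!: derivative_eq_intros)
  moreover have "J e = 0"
    using e by (simp add: J_def)
  ultimately show "((\<lambda>s. R (P w * (G (w \<bullet> e + s) - G (w \<bullet> e))) w + s *\<^sub>R e) has_vector_derivative
      e + (P (R (P w * (G (w \<bullet> e + t) - G (w \<bullet> e))) w + t *\<^sub>R e) *
         g ((R (P w * (G (w \<bullet> e + t) - G (w \<bullet> e))) w + t *\<^sub>R e) \<bullet> e)) *\<^sub>R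
        J (R (P w * (G (w \<bullet> e + t) - G (w \<bullet> e))) w + t *\<^sub>R e)) (at t)"
    unfolding P \<sigma>_def
    by (simp add: inner_add_left R_orthogonal e J_simps)
qed (simp add: R_0)

end

text \<open>
  Gram-Schmidt applied to \<open>a\<close> and \<open>b\<close>. When they are parallel the second vector of the plane is
  not determined and any unit vector orthogonal to \<open>a\<close> serves; it exists since the dimension is
  at least \<open>2\<close>.
\<close>

lemma ex_oriented_plane:
  fixes a b :: "'a::euclidean_space"
  assumes "DIM('a) \<ge> 2" "\<delta> > 0" "norm a = \<delta>" "norm b = \<delta>"
  shows "\<exists>u v. oriented_plane u v \<and> a = \<delta> *\<^sub>R u \<and>
    b = \<delta> *\<^sub>R (cos (angle a b) *\<^sub>R u + sin (angle a b) *\<^sub>R v)"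
proof -
  define u \<theta> where "u = a /\<^sub>R \<delta>" and "\<theta> = angle a b"
  have a: "a = \<delta> *\<^sub>R u" and nu: "norm u = 1"
    using assms by (simp_all add: u_def)
  have "\<bar>a \<bullet> b\<bar> \<le> \<delta> * \<delta>"
    using Cauchy_Schwarz_ineq2[of a b] assms by simp
  then have "\<bar>(a \<bullet> b) / (norm a * norm b)\<bar> \<le> 1"
    using assms by simp
  then have cos: "cos \<theta> = (a \<bullet> b) / (\<delta> * \<delta>)"
    unfolding \<theta>_def angle_def using assms by (simp add: cos_arccos_abs)
  define w where "w = b /\<^sub>R \<delta> - cos \<theta> *\<^sub>R u"
  have uu: "u \<bullet> u = 1" using nu by (simp add: norm_eq_1)
  have bb: "b \<bullet> b = \<delta> * \<delta>" using assms by (simp add: dot_square_norm power2_eq_square)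
  have ub: "u \<bullet> b = \<delta> * cos \<theta>" using assms by (simp add: cos u_def field_simps)
  have wu: "w \<bullet> u = 0"
    using ub uu assms by (simp add: w_def inner_simps inner_commute)
  have "w \<bullet> w = 1 - (cos \<theta>)\<^sup>2"
    using bb uu ub assms
    by (simp add: w_def inner_simps inner_commute[of b u]) (simp add: field_simps power2_eq_square)
  then have ww: "w \<bullet> w = (sin \<theta>)\<^sup>2"
    by (simp add: sin_squared_eq)
  have "\<exists>v. v \<bullet> v = 1 \<and> u \<bullet> v = 0 \<and> w = sin \<theta> *\<^sub>R v"
  proof (cases "sin \<theta> = 0")
    case True
    obtain y where "y \<noteq> 0" "orthogonal u y"
      using orthogonal_to_vector_exists[OF assms(1)] by blast
    then show ?thesis
      using True ww
      by (intro exI[of _ "y /\<^sub>R norm y"]) (auto simp: orthogonal_def dot_square_norm power2_eq_square)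
  next
    case False
    then show ?thesis
      using ww wu by (intro exI[of _ "w /\<^sub>R sin \<theta>"]) (auto simp: inner_commute power2_eq_square field_simps)
  qed
  then obtain v where v: "v \<bullet> v = 1" "u \<bullet> v = 0" "w = sin \<theta> *\<^sub>R v" by blast
  have "b = \<delta> *\<^sub>R (cos \<theta> *\<^sub>R u + w)"
    using assms by (simp add: w_def)
  with v a uu show ?thesis
    unfolding \<theta>_def by (intro exI[of _ u] exI[of _ v]) (simp add: oriented_plane_def)
qed

section \<open>The volume form\<close>

definition coordinate_basis :: "'n::finite option option \<Rightarrow> 'n total" where
  "coordinate_basis k = (case k of
       None \<Rightarrow> ((0, 0), 1)
     | Some None \<Rightarrow> ((0, 1), 0)
     | Some (Some i) \<Rightarrow> ((axis i 1, 0), 0))"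

lemma coordinate_coordinate_basis:
  "coordinate i (coordinate_basis j) = (if i = j then 1 else 0)"
  by (auto simp: coordinate_def coordinate_basis_def axis_def split: option.splits)

lemma linear_coordinate: "linear (coordinate k)"
  by (intro linearI) (auto simp: coordinate_def split: option.splits)

lemma sum_coordinate_basis: "(\<Sum>k\<in>UNIV. coordinate k w *\<^sub>R coordinate_basis k) = w"
proof -
  have eq: "x = y" if "\<And>k. coordinate k x = coordinate k y" for x y :: "'n::finite total"
    using that[of None] that[of "Some None"] that[of "Some (Some i)" for i]
    by (auto simp: coordinate_def prod_eq_iff vec_eq_iff)
  show ?thesis
    by (rule eq)
      (simp add: linear_sum[OF linear_coordinate] linear_cmul[OF linear_coordinate]
        coordinate_coordinate_basis sum.delta' if_distrib cong: if_cong)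
qed

lemma volume_form_coordinate_basis: "volume_form coordinate_basis = 1"
  by (simp add: volume_form_def coordinate_coordinate_basis flip: mat_def)

text \<open>
  A linear map multiplies the volume form by its determinant, expressed here as the volume of the
  image of the standard basis.
\<close>

lemma volume_form_linear:
  assumes "linear F"
  shows "volume_form (\<lambda>j. F (v j)) = volume_form (\<lambda>j. F (coordinate_basis j)) * volume_form v"
proof -
  have "coordinate i (F w) = (\<Sum>k\<in>UNIV. coordinate i (F (coordinate_basis k)) * coordinate k w)" for i w
  proof -
    have "F w = (\<Sum>k\<in>UNIV. coordinate k w *\<^sub>R F (coordinate_basis k))"
      by (subst sum_coordinate_basis[of w, symmetric])
        (simp add: linear_sum[OF assms] linear_cmul[OF assms])
    then show ?thesis
      by (simp add: linear_sum[OF linear_coordinate] linear_cmul[OF linear_coordinate] mult.commute)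
  qed
  then have "(\<chi> i j. coordinate i (F (v j))) =
      (\<chi> i j. coordinate i (F (coordinate_basis j))) ** (\<chi> i j. coordinate i (v j))"
    unfolding matrix_matrix_mult_def vec_eq_iff vec_lambda_beta by (intro allI)
  then show ?thesis
    unfolding volume_form_def det_mul[symmetric] by (rule arg_cong)
qed

text \<open>
  Conjugation by \<open>S\<close> gives \<open>F s\<close> and its inverse \<open>F (- s)\<close> the same determinant, which is thus
  \<open>1\<close> or \<open>- 1\<close>; being the square of the determinant of \<open>F (s / 2)\<close>, it is not negative.
\<close>

lemma volume_form_reversible_group:
  fixes F :: "real \<Rightarrow> 'n::finite total \<Rightarrow> 'n total"
  assumes lin: "\<And>s. linear (F s)" "linear S"
    and F: "\<And>w. F 0 w = w" "\<And>s t w. F (s + t) w = F s (F t w)"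
    and S: "\<And>w. S (S w) = w" "\<And>s w. S (F s (S w)) = F (- s) w"
  shows "volume_form (\<lambda>j. F s (v j)) = volume_form v"
proof -
  define d where "d = (\<lambda>H :: 'n total \<Rightarrow> 'n total. volume_form (\<lambda>j. H (coordinate_basis j)))"
  have comp: "d (\<lambda>w. H (K w)) = d H * d K" if "linear H" for H K
    unfolding d_def by (rule volume_form_linear[OF that])
  have id: "d (\<lambda>w. w) = 1"
    by (simp add: d_def volume_form_coordinate_basis)
  have SS: "d S * d S = 1"
    using comp[OF lin(2), of S] id by (simp add: S(1))
  have "d (F (- s)) = d S * (d (F s) * d S)"
    using comp[OF lin(2), of "\<lambda>w. F s (S w)"] comp[OF lin(1)[of s], of S] by (simp add: S(2))
  then have "d (F (- s)) = d (F s)"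
    using SS by (simp add: mult.left_commute)
  moreover have "d (F s) * d (F (- s)) = 1"
    using comp[OF lin(1)[of s], of "F (- s)"] id by (simp add: F flip: F(2))
  ultimately have "(d (F s))\<^sup>2 = 1"
    by (simp add: power2_eq_square)
  moreover have "d (F s) = (d (F (s / 2)))\<^sup>2"
    using comp[OF lin(1)[of "s / 2"], of "F (s / 2)"]
    by (simp add: power2_eq_square flip: F(2))
  then have "d (F s) \<ge> 0" by simp
  ultimately have "d (F s) = 1"
    by (auto simp: power2_eq_1_iff)
  then show ?thesis
    using volume_form_linear[OF lin(1)[of s], of v] by (simp add: d_def)
qed

text \<open>
  The shears \<open>w + s l(w) n\<close> form a one-parameter group, as \<open>l n = 0\<close>. The reflection in the
  hyperplane orthogonal to \<open>n\<close> negates \<open>n\<close> and leaves \<open>l\<close> invariant, so it reverses the group.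
\<close>

lemma volume_form_shear:
  assumes l: "linear l" and n: "l n = 0"
  shows "volume_form (\<lambda>j. v j + l (v j) *\<^sub>R n) = volume_form v"
proof -
  define F where "F = (\<lambda>s w. w + (s * l w) *\<^sub>R n)"
  \<comment> \<open>For \<open>n = 0\<close> division by zero makes \<open>S\<close> the identity, and \<open>S n = - n\<close> still holds.\<close>
  define S where "S = (\<lambda>w. w - (2 * (w \<bullet> n) / (n \<bullet> n)) *\<^sub>R n)"
  have Sn: "S n = - n" by (cases "n = 0") (simp_all add: S_def scaleR_2)
  have lS: "l (S w) = l w" for w
    by (simp add: S_def linear_diff[OF l] linear_cmul[OF l] n)
  have lin: "linear S"
    unfolding S_def by (intro linearI) (simp_all add: inner_simps algebra_simps add_divide_distrib)
  have "volume_form (\<lambda>j. F 1 (v j)) = volume_form v"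
  proof (rule volume_form_reversible_group[of F S])
    show "linear (F s)" for s
      unfolding F_def by (intro linearI) (simp_all add: linear_add[OF l] linear_cmul[OF l] algebra_simps)
    show "F (s + t) w = F s (F t w)" for s t w
      by (simp add: F_def linear_add[OF l] linear_cmul[OF l] n algebra_simps)
    show SS: "S (S w) = w" for w
    proof -
      have "S (S w) = S w - (2 * (w \<bullet> n) / (n \<bullet> n)) *\<^sub>R S n"
        by (subst (2) S_def) (simp add: linear_diff[OF lin] linear_cmul[OF lin])
      then show ?thesis unfolding Sn by (simp add: S_def)
    qed
    show "S (F s (S w)) = F (- s) w" for s w
    proof -
      have "S (F s (S w)) = S (S w) + (s * l w) *\<^sub>R S n"
        by (simp add: F_def lS linear_add[OF lin] linear_cmul[OF lin])
      then show ?thesis unfolding SS Sn by (simp add: F_def)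
    qed
  qed (simp_all add: F_def lin)
  then show ?thesis by (simp add: F_def)
qed

text \<open>
  The reflection that fixes \<open>u\<close> and negates \<open>v\<close> reverses the orientation of the plane, hence the
  sense of rotation.
\<close>

lemma volume_form_rotation:
  fixes u v :: "'n::finite total"
  assumes "oriented_plane u v"
  shows "volume_form (\<lambda>j. oriented_plane.R u v s (w j)) = volume_form w"
proof -
  interpret oriented_plane u v by fact
  define S where "S = (\<lambda>w. w - (2 * (w \<bullet> v)) *\<^sub>R v)"
  have lin: "linear S"
    unfolding S_def by (intro linearI) (simp_all add: inner_simps algebra_simps)
  have SS: "S (S w) = w" for w
    by (simp add: S_def inner_simps vv)
  have "S u = u" "S v = - v"
    by (simp_all add: S_def uv vv scaleR_2)
  moreover have "J (S w) = (w \<bullet> u) *\<^sub>R v + (w \<bullet> v) *\<^sub>R u" for w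
    by (simp add: J_def S_def inner_simps vu vv)
  ultimately have SJ: "S (J (S w)) = - J w" for w
    by (simp add: linear_add[OF lin] linear_cmul[OF lin] J_def)
  have "S (J (J (S w))) = J (J w)" for w
  proof -
    have "S (J (J (S w))) = S (J (S (S (J (S w)))))"
      by (simp only: SS)
    also have "\<dots> = J (J w)"
      by (simp only: SJ linear_neg[OF linear_J] minus_minus)
    finally show ?thesis .
  qed
  then have "S (R s (S w)) = R (- s) w" for s w
    by (simp add: R_def linear_add[OF lin] linear_cmul[OF lin] SS SJ)
  then show ?thesis
    by (intro volume_form_reversible_group[of R S] linear_R lin R_0 R_add SS)
qed

lemma twist_preserves_volume_form:
  fixes u v e :: "'n::finite total"
  assumes plane: "oriented_plane u v" and e: "e \<bullet> u = 0" "e \<bullet> v = 0"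
    and P: "\<And>s w. P (oriented_plane.R u v s w) = P w" "\<And>w. P differentiable (at w)"
    and G: "\<And>z. (G has_real_derivative g z) (at z)"
  shows "preserves_volume_form
    (\<lambda>w. oriented_plane.R u v (P w * (G (w \<bullet> e + t) - G (w \<bullet> e))) w + t *\<^sub>R e)"
proof -
  interpret oriented_plane u v by fact
  define \<sigma> where "\<sigma> = (\<lambda>w. P w * (G (w \<bullet> e + t) - G (w \<bullet> e)))"
  define F where "F = (\<lambda>w. R (\<sigma> w) w + t *\<^sub>R e)"
  have "F differentiable (at w) \<and>
      (\<forall>v. volume_form (\<lambda>j. frechet_derivative F (at w) (v j)) = volume_form v)" for w
  proof -
    obtain DP where DP: "(P has_derivative DP) (at w)"
      using P(2)[of w] by (auto simp: differentiable_def)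
    have DG: "((\<lambda>w. G (w \<bullet> e + c)) has_derivative (\<lambda>k. (k \<bullet> e) * g (w \<bullet> e + c))) (at w)" for c
      by (rule DERIV_compose_FDERIV[OF G]) (auto intro!: derivative_eq_intros)
    obtain D where D: "(\<sigma> has_derivative D) (at w)"
      using has_derivative_mult[OF DP has_derivative_diff[OF DG[of t] DG[of 0]]]
      unfolding \<sigma>_def add_0_right by blast
    have inv: "\<sigma> (R s w) = \<sigma> w" for s
      by (simp add: \<sigma>_def P(1) R_orthogonal(1)[OF e])
    note twist = twist_has_derivative[OF D inv]
    have dF: "(F has_derivative (\<lambda>k. R (\<sigma> w) (k + D k *\<^sub>R J w))) (at w)"
      unfolding F_def using has_derivative_add[OF twist(1) has_derivative_const[of "t *\<^sub>R e"]]
      by simp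
    have "volume_form (\<lambda>j. R (\<sigma> w) (v j + D (v j) *\<^sub>R J w)) = volume_form v" for v
      using volume_form_rotation[OF plane, of "\<sigma> w" "\<lambda>j. v j + D (v j) *\<^sub>R J w"]
        volume_form_shear[OF has_derivative_linear[OF D] twist(2), of v]
      by simp
    then show ?thesis
      using dF unfolding frechet_derivative_at[OF dF, symmetric] by (auto simp: differentiable_def)
  qed
  then show ?thesis
    unfolding preserves_volume_form_def F_def \<sigma>_def by blast
qed

section \<open>The perturbation\<close>

text \<open>
  The norm itself is not smooth at the axis, so the bump is written as a function of its square.
\<close>

lemma ex_ring_bump:
  fixes \<delta> \<xi> :: real
  assumes "0 < \<xi>" "\<xi> < \<delta>"
  shows "\<exists>P :: 'a::euclidean_space \<times> real \<Rightarrow> real. smooth_expr P \<and>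
    (\<forall>w w'. norm (fst w) = norm (fst w') \<longrightarrow> P w = P w') \<and>
    (\<forall>w. P w \<noteq> 0 \<longrightarrow> \<delta> - \<xi> < norm (fst w) \<and> norm (fst w) < \<delta> + \<xi>) \<and>
    (\<forall>w. norm (fst w) = \<delta> \<longrightarrow> P w = 1)"
proof -
  define c where "c = flat 0 (\<delta>\<^sup>2 - (\<delta> - \<xi>)\<^sup>2) * flat 0 ((\<delta> + \<xi>)\<^sup>2 - \<delta>\<^sup>2)"
  define P :: "'a \<times> real \<Rightarrow> real" where
    "P = (\<lambda>w. (1 / c) * (flat 0 ((norm (fst w))\<^sup>2 - (\<delta> - \<xi>)\<^sup>2) *
       flat 0 ((\<delta> + \<xi>)\<^sup>2 - (norm (fst w))\<^sup>2)))"
  have "c > 0"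
    unfolding c_def using assms by (intro mult_pos_pos flat_0_pos) (simp_all add: power_strict_mono)
  have "(norm (fst w))\<^sup>2 = w \<bullet> w - (w \<bullet> (0, 1)) * (w \<bullet> (0, 1))" for w :: "'a \<times> real"
    by (cases w) (simp add: inner_Pair flip: dot_square_norm)
  then have "smooth_expr P"
    unfolding P_def
    by (simp only:) (intro smooth_expr.mult smooth_expr.flat smooth_expr_minus smooth_expr_inner_self
        smooth_expr.coord smooth_expr.const)
  moreover have "\<delta> - \<xi> < norm (fst w) \<and> norm (fst w) < \<delta> + \<xi>" if "P w \<noteq> 0" for w
  proof -
    from that have "(\<delta> - \<xi>)\<^sup>2 < (norm (fst w))\<^sup>2" "(norm (fst w))\<^sup>2 < (\<delta> + \<xi>)\<^sup>2"
      unfolding P_def by (auto dest!: flat_nonzeroD)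
    then show ?thesis
      using assms by (auto intro: power_less_imp_less_base)
  qed
  moreover have "P w = 1" if "norm (fst w) = \<delta>" for w
    unfolding P_def that c_def[symmetric] using \<open>c > 0\<close> by simp
  moreover have "P w = P w'" if "norm (fst w) = norm (fst w')" for w w'
    unfolding P_def that ..
  ultimately show ?thesis by blast
qed

text \<open>
  A product of two flat functions, divided by its integral over \<open>[0, h]\<close>. The primitive \<open>G\<close> is
  kept with the bump because the angle of rotation is expressed by it.
\<close>

lemma ex_interval_bump:
  fixes h :: real
  assumes "h > 0"
  shows "\<exists>g G. (\<forall>f :: 'a::euclidean_space \<Rightarrow> real. smooth_expr f \<longrightarrow> smooth_expr (\<lambda>w. g (f w))) \<and>
    (\<forall>z. g z \<noteq> 0 \<longrightarrow> 0 < z \<and> z < h) \<and>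
    (\<forall>z. (G has_real_derivative g z) (at z)) \<and> G h - G 0 = 1"
proof -
  define k where "k = (\<lambda>z. flat 0 z * flat 0 (h - z))"
  have flat: "isCont (flat 0) z" for z
    by (rule DERIV_isCont[OF flat_has_derivative])
  have "isCont k z" for z
    unfolding k_def by (intro continuous_intros flat isCont_o2[OF _ flat])
  then obtain H where H: "\<And>z. (H has_real_derivative k z) (at z)"
    using einterval_antiderivative[of "-\<infinity>" "\<infinity>" k]
    by (auto simp: has_real_derivative_iff_has_vector_derivative)
  have "H 0 < H h"
  proof (rule DERIV_pos_imp_increasing_open[OF assms])
    show "\<exists>y. (H has_real_derivative y) (at z) \<and> 0 < y" if "0 < z" "z < h" for z
      using H[of z] that by (intro exI[of _ "k z"]) (simp add: k_def flat_0_pos)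
    show "continuous_on {0..h} H"
      using H by (intro continuous_at_imp_continuous_on) (auto intro: DERIV_isCont)
  qed
  define m where "m = H h - H 0"
  have "m > 0" using \<open>H 0 < H h\<close> by (simp add: m_def)
  show ?thesis
  proof (rule exI[of _ "\<lambda>z. (1 / m) * k z"], rule exI[of _ "\<lambda>z. (1 / m) * H z"], intro conjI allI impI)
    fix f :: "'a \<Rightarrow> real" assume "smooth_expr f"
    then show "smooth_expr (\<lambda>w. (1 / m) * k (f w))"
      unfolding k_def
      by (intro smooth_expr.mult smooth_expr.flat smooth_expr_minus smooth_expr.const)
  next
    fix z
    assume "(1 / m) * k z \<noteq> 0"
    then show "0 < z" "z < h"
      unfolding k_def by (auto dest!: flat_nonzeroD)
  next
    show "((\<lambda>z. (1 / m) * H z) has_real_derivative (1 / m) * k z) (at z)" for z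
      by (intro DERIV_cmult H)
    show "(1 / m) * H h - (1 / m) * H 0 = 1"
      using \<open>m > 0\<close> by (simp add: m_def diff_divide_distrib[symmetric])
  qed
qed

theorem lemma4p2:
  fixes \<delta> h \<xi> :: real
  assumes "\<delta> > 0" and "h > 0" and "0 < \<xi>" and "\<xi> < \<delta>"
  shows "\<exists>Z :: 'n::finite total \<Rightarrow> 'n total \<Rightarrow> 'n total \<Rightarrow> 'n total.
    (\<forall>p \<in> frontier (ball (0, 0) \<delta>) \<times> {0}. \<forall>q \<in> frontier (ball (0, 0) \<delta>) \<times> {h}.
       smooth (Z p q) \<and>
       (\<exists>\<phi>. is_flow (Z p q) \<phi> \<and>
          (\<forall>t. preserves_volume_form (\<phi> t)) \<and>
          q \<in> positive_orbit \<phi> p) \<and>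
       (\<forall>x. x \<notin> cylinder_ring (0, 0) \<delta> h \<xi> \<longrightarrow> Z p q x = vertical_field x)) \<and>
    (\<forall>r::nat. \<forall>\<epsilon>>0. \<exists>\<eta>>0.
       \<forall>p \<in> frontier (ball (0, 0) \<delta>) \<times> {0}. \<forall>q \<in> frontier (ball (0, 0) \<delta>) \<times> {h}.
         \<bar>angle (p - ((0, 0), 0)) (q - ((0, 0), h))\<bar> < \<eta> \<longrightarrow>
         Cr_norm r (\<lambda>x. Z p q x - vertical_field x) < ereal \<epsilon>)"
proof -
  obtain P :: "'n total \<Rightarrow> real" where smP: "smooth_expr P"
    and Pnorm: "\<And>w w'. norm (fst w) = norm (fst w') \<Longrightarrow> P w = P w'"
    and Psupp: "\<And>w. P w \<noteq> 0 \<Longrightarrow> \<delta> - \<xi> < norm (fst w) \<and> norm (fst w) < \<delta> + \<xi>"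
    and P1: "\<And>w. norm (fst w) = \<delta> \<Longrightarrow> P w = 1"
    using ex_ring_bump[OF assms(3,4), where 'a = "'n base"] by blast
  obtain g G where smg: "\<And>f :: 'n total \<Rightarrow> real. smooth_expr f \<Longrightarrow> smooth_expr (\<lambda>w. g (f w))"
    and gsupp: "\<And>z. g z \<noteq> 0 \<Longrightarrow> 0 < z \<and> z < h"
    and G: "\<And>z. (G has_real_derivative g z) (at z)" and G1: "G h - G 0 = 1"
    using ex_interval_bump[OF assms(2), where 'a = "'n total"] by metis
  define e :: "'n total" where "e = ((0, 0), 1)"
  have we: "w \<bullet> e = snd w" for w
    by (cases w) (simp add: e_def inner_Pair flip: zero_prod_def)
  define \<zeta> where "\<zeta> = (\<lambda>w. P w * g (w \<bullet> e))"
  have sm\<zeta>: "smooth_expr \<zeta>"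
    unfolding \<zeta>_def by (intro smooth_expr.mult smP smg smooth_expr.coord)
  have \<zeta>0: "\<zeta> w = 0" if "w \<notin> cylinder_ring (0, 0) \<delta> h \<xi>" for w
  proof (rule ccontr)
    assume "\<zeta> w \<noteq> 0"
    with Psupp[of w] gsupp[of "snd w"] have "w \<in> cylinder_ring (0, 0) \<delta> h \<xi>"
      by (cases w) (auto simp: cylinder_ring_def \<zeta>_def we dist_norm simp flip: zero_prod_def)
    with that show False by blast
  qed

  \<comment> \<open>The plane is chosen separately for each pair of points; \<open>\<zeta>\<close> has been fixed before that.\<close>
  have "DIM('n base) \<ge> 2"
    by simp
  then have "\<exists>u v. norm a = \<delta> \<and> norm b = \<delta> \<longrightarrow> oriented_plane u v \<and> a = \<delta> *\<^sub>R u \<and>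
      b = \<delta> *\<^sub>R (cos (angle a b) *\<^sub>R u + sin (angle a b) *\<^sub>R v)" for a b :: "'n base"
    using ex_oriented_plane[of \<delta> a b] assms(1) by blast
  then obtain U V where UV: "\<And>a b :: 'n base. norm a = \<delta> \<Longrightarrow> norm b = \<delta> \<Longrightarrow>
      oriented_plane (U a b) (V a b) \<and> a = \<delta> *\<^sub>R U a b \<and>
      b = \<delta> *\<^sub>R (cos (angle a b) *\<^sub>R U a b + sin (angle a b) *\<^sub>R V a b)"
    by metis
  define T where "T = (\<lambda>(p :: 'n total) (q :: 'n total).
    oriented_plane.J (U (fst p) (fst q), 0 :: real) (V (fst p) (fst q), 0))"
  define \<theta> where "\<theta> = (\<lambda>(p :: 'n total) (q :: 'n total). angle (fst p) (fst q))"
  define Z where "Z = (\<lambda>p q w. e + \<zeta> w *\<^sub>R (\<theta> p q *\<^sub>R T p q w))"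
  have plane: "oriented_plane (U (fst p) (fst q), 0 :: real) (V (fst p) (fst q), 0)"
    if "norm (fst p) = \<delta>" "norm (fst q) = \<delta>" for p q :: "'n total"
    using UV[OF that] by (simp add: oriented_plane_def inner_Pair)
  have linT: "linear (\<lambda>w. \<theta> p q *\<^sub>R T p q w)" if "norm (fst p) = \<delta>" "norm (fst q) = \<delta>" for p q :: "'n total"
    unfolding T_def by (intro linear_compose_scale_right oriented_plane.linear_J[OF plane[OF that]])

  have one: "smooth (Z p q) \<and>
       (\<exists>\<phi>. is_flow (Z p q) \<phi> \<and> (\<forall>t. preserves_volume_form (\<phi> t)) \<and> q \<in> positive_orbit \<phi> p)"
    if p: "norm (fst p) = \<delta>" "snd p = 0" and q: "norm (fst q) = \<delta>" "snd q = h" for p q :: "'n total"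
  proof -
    define u v where "u = (U (fst p) (fst q), 0 :: real)" and "v = (V (fst p) (fst q), 0 :: real)"
    interpret oriented_plane u v
      unfolding u_def v_def by (rule plane[OF p(1) q(1)])
    have eu: "e \<bullet> e = 1" "e \<bullet> u = 0" "e \<bullet> v = 0"
      by (simp_all add: e_def u_def v_def inner_Pair flip: zero_prod_def)
    have norm_fst_R: "norm (fst (R s w)) = norm (fst w)" for s w
    proof -
      have "w \<bullet> w = fst w \<bullet> fst w + (w \<bullet> e)\<^sup>2" for w
        by (cases w) (simp add: we inner_Pair power2_eq_square)
      from this[of w] this[of "R s w"] have "fst (R s w) \<bullet> fst (R s w) = fst w \<bullet> fst w"
        by (simp add: inner_R R_orthogonal(1)[OF eu(2,3)])
      then show ?thesis by (simp add: norm_eq_sqrt_inner)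
    qed
    have PR: "\<theta> p q * P (R s w) = \<theta> p q * P w" for s w
      using Pnorm[OF norm_fst_R] by simp
    have Pe: "\<theta> p q * P (w + t *\<^sub>R e) = \<theta> p q * P w" for t w
      using Pnorm[of "w + t *\<^sub>R e" w] by (simp add: e_def flip: zero_prod_def)
    have Pd: "(\<lambda>w. \<theta> p q * P w) differentiable (at w)" for w
      using smooth_expr_has_derivative[OF smP] differentiable_def
      by (intro differentiable_mult differentiable_const) blast
    define \<phi> where "\<phi> = (\<lambda>t w. R (\<theta> p q * P w * (G (w \<bullet> e + t) - G (w \<bullet> e))) w + t *\<^sub>R e)"
    have Z: "Z p q = (\<lambda>w. e + (\<theta> p q * P w * g (w \<bullet> e)) *\<^sub>R J w)"
      unfolding Z_def T_def \<zeta>_def u_def[symmetric] v_def[symmetric] by (simp add: mult_ac)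
    have "is_flow (Z p q) \<phi>"
      unfolding Z \<phi>_def using twist_is_flow[OF eu PR Pe G] .
    moreover have "preserves_volume_form (\<phi> t)" for t
      unfolding \<phi>_def
      by (rule twist_preserves_volume_form[OF oriented_plane_axioms eu(2,3) PR Pd G])
    moreover have "\<phi> h p = q"
    proof -
      define \<beta> where "\<beta> = angle (fst p) (fst q)"
      have pu: "p = \<delta> *\<^sub>R u" and qu: "q = \<delta> *\<^sub>R (cos \<beta> *\<^sub>R u + sin \<beta> *\<^sub>R v) + h *\<^sub>R e"
        using UV[OF p(1) q(1)] p(2) q(2)
        by (auto simp: prod_eq_iff u_def v_def e_def \<beta>_def)
      have "\<phi> h p = R \<beta> p + h *\<^sub>R e"
        using P1[OF p(1)] G1 by (simp add: \<phi>_def we p(2) \<theta>_def \<beta>_def)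
      also have "R \<beta> p = \<delta> *\<^sub>R (cos \<beta> *\<^sub>R u + sin \<beta> *\<^sub>R v)"
        unfolding R_def J_J by (simp add: pu J_def uu uv inner_commute[of v u] algebra_simps)
      finally show ?thesis by (simp only: qu)
    qed
    then have "q \<in> positive_orbit \<phi> p"
      unfolding positive_orbit_def using assms(2) by (force intro: less_imp_le)
    moreover have "smooth (Z p q)"
      unfolding Z_def by (intro smooth_add smooth_const smooth_scaleR_linear sm\<zeta> linT p q)
    ultimately show ?thesis by blast
  qed

  have small: "\<exists>\<eta>>0. \<forall>p q. norm (fst p) = \<delta> \<longrightarrow> norm (fst q) = \<delta> \<longrightarrow> \<bar>\<theta> p q\<bar> < \<eta> \<longrightarrow>
      Cr_norm r (\<lambda>x. Z p q x - vertical_field x) < ereal \<epsilon>" if "\<epsilon> > 0" for r \<epsilon>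
  proof -
    have K: "compact (cball (0 :: 'n base) (\<delta> + \<xi>) \<times> {0..h})"
      by (intro compact_Times) auto
    have \<zeta>K: "\<zeta> w = 0" if "w \<notin> cball 0 (\<delta> + \<xi>) \<times> {0..h}" for w
      by (rule \<zeta>0) (use that in \<open>auto simp: cylinder_ring_def simp flip: zero_prod_def\<close>)
    obtain C where "C \<ge> 0" and C: "\<And>(L :: 'n total \<Rightarrow> 'n total) B. linear L \<Longrightarrow>
        \<forall>b\<in>Basis. norm (L b) \<le> B \<Longrightarrow> Cr_norm r (\<lambda>x. \<zeta> x *\<^sub>R L x) \<le> ereal (C * B)"
      using Cr_norm_scaleR_linear_le[OF sm\<zeta> K \<zeta>K, of r] by blast
    show ?thesis
    proof (intro exI[of _ "\<epsilon> / (2 * C + 1)"] conjI allI impI)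
      \<comment> \<open>The factor \<open>2\<close> comes from the bound of \<open>J\<close>; adding \<open>1\<close> covers the case \<open>C = 0\<close>.\<close>
      show "\<epsilon> / (2 * C + 1) > 0" using \<open>C \<ge> 0\<close> that by simp
      fix p q :: "'n total"
      assume pq: "norm (fst p) = \<delta>" "norm (fst q) = \<delta>" and th: "\<bar>\<theta> p q\<bar> < \<epsilon> / (2 * C + 1)"
      have "Cr_norm r (\<lambda>x. \<zeta> x *\<^sub>R (\<theta> p q *\<^sub>R T p q x)) \<le> ereal (C * (\<bar>\<theta> p q\<bar> * 2))"
      proof (intro C linT[OF pq] ballI)
        fix b :: "'n total" assume "b \<in> Basis"
        then have "norm (T p q b) \<le> 2"
          unfolding T_def using oriented_plane.norm_J_le[OF plane[OF pq], of b] by simp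
        then show "norm (\<theta> p q *\<^sub>R T p q b) \<le> \<bar>\<theta> p q\<bar> * 2"
          by (simp add: mult_left_mono)
      qed
      also have "C * (\<bar>\<theta> p q\<bar> * 2) < \<epsilon>"
      proof -
        have "\<bar>\<theta> p q\<bar> * (2 * C + 1) < \<epsilon>"
          using th \<open>C \<ge> 0\<close> by (simp add: pos_less_divide_eq)
        then show ?thesis
          by (simp add: algebra_simps)
      qed
      finally show "Cr_norm r (\<lambda>x. Z p q x - vertical_field x) < ereal \<epsilon>"
        by (simp add: Z_def vertical_field_def e_def)
    qed
  qed

  have angle: "angle (p - ((0, 0), 0)) (q - ((0, 0), h)) = \<theta> p q"
    if "snd p = 0" "snd q = h" for p q :: "'n total"
    using that by (cases p, cases q) (simp add: angle_def \<theta>_def inner_Pair norm_Pair flip: zero_prod_def)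
  have sphere: "norm (fst w) = \<delta> \<and> snd w = z"
    if "w \<in> frontier (ball (0, 0) \<delta>) \<times> {z}" for w :: "'n total" and z
    using that assms(1) by (auto simp: frontier_ball simp flip: zero_prod_def)
  show ?thesis
  proof (intro exI[of _ Z] conjI ballI allI impI)
    fix p q :: "'n total"
    assume "p \<in> frontier (ball (0, 0) \<delta>) \<times> {0}" "q \<in> frontier (ball (0, 0) \<delta>) \<times> {h}"
    note pq = sphere[OF this(1)] sphere[OF this(2)]
    show "smooth (Z p q)"
      "\<exists>\<phi>. is_flow (Z p q) \<phi> \<and> (\<forall>t. preserves_volume_form (\<phi> t)) \<and> q \<in> positive_orbit \<phi> p"
      using one pq by blast+
    show "Z p q x = vertical_field x" if "x \<notin> cylinder_ring (0, 0) \<delta> h \<xi>" for x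
      using \<zeta>0[OF that] by (simp add: Z_def vertical_field_def e_def)
  next
    fix r :: nat and \<epsilon> :: real assume "\<epsilon> > 0"
    from small[OF this, of r] obtain \<eta> where "\<eta> > 0" and \<eta>: "\<And>p q. norm (fst p) = \<delta> \<Longrightarrow>
        norm (fst q) = \<delta> \<Longrightarrow> \<bar>\<theta> p q\<bar> < \<eta> \<Longrightarrow> Cr_norm r (\<lambda>x. Z p q x - vertical_field x) < ereal \<epsilon>"
      by blast
    show "\<exists>\<eta>>0. \<forall>p \<in> frontier (ball (0, 0) \<delta>) \<times> {0}. \<forall>q \<in> frontier (ball (0, 0) \<delta>) \<times> {h}.
         \<bar>angle (p - ((0, 0), 0)) (q - ((0, 0), h))\<bar> < \<eta> \<longrightarrow>
         Cr_norm r (\<lambda>x. Z p q x - vertical_field x) < ereal \<epsilon>"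
    proof (intro exI[of _ \<eta>] conjI ballI impI \<open>\<eta> > 0\<close>)
      fix p q :: "'n total"
      assume "p \<in> frontier (ball (0, 0) \<delta>) \<times> {0}" "q \<in> frontier (ball (0, 0) \<delta>) \<times> {h}"
        and th: "\<bar>angle (p - ((0, 0), 0)) (q - ((0, 0), h))\<bar> < \<eta>"
      note pq = sphere[OF this(1)] sphere[OF this(2)]
      show "Cr_norm r (\<lambda>x. Z p q x - vertical_field x) < ereal \<epsilon>"
        by (rule \<eta>) (use pq th angle[of p q] in auto)
    qed
  qed
qed

end
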